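(* Let $n>2$. For $0\le\sigma_1,\dots,\sigma_n<1$, the condition $\sum_{j=1}^n\sqrt{1-\sigma_j^2}>n-1$ is sufficient but not necessary for the existence of a reduced pointed degree-three sphere map with denominator $1+\sum_{j=1}^n\sigma_jz_j^2$. More precisely, if \[ \frac{\sqrt{2n-1}}{n}\le\sigma<\sqrt{\frac{3}{n+2}}, \] (a nonempty range of $\sigma$), then there is a reduced pointed degree-three sphere map with denominator $1+\sigma\sum_{j=1}^nz_j^2$, but the condition above fails for $\sigma_1=\dots=\sigma_n=\sigma$, i.e. $n\sqrt{1-\sigma^2}\le n-1$.
   Context: $\mathbb B^n$ is the open unit ball of $\mathbb C^n$. A (rational) sphere map with denominator $g$ is a rational map $F=P/g$, holomorphic on $\mathbb B^n$, with $P=(p_1,\dots,p_N)^t\colon\mathbb C^n\to\mathbb C^N$ a polynomial map (for some $N$) and $\|P(z)\|^2=|g(z)|^2$ for all $z\in\partial\mathbb B^n$. It is reduced if $g,p_1,\dots,p_N$ have no common nonconstant polynomial factor; then $\deg F=\max\{\deg P,\deg g\}$. With $g(0)=1$, it is pointed if $P(0)=0$. *)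

theory Defs
  imports "HOL-Analysis.Analysis" "HOL-Library.Poly_Mapping"
begin

text \<open>Polynomials on \<open>complex ^ 'n\<close>: exponent vectors are elements of \<open>'n \<Rightarrow>\<^sub>0 nat\<close>, and the
  ring structure (hence divisibility) is the convolution structure of \<open>Poly_Mapping\<close>.\<close>

type_synonym 'n cpoly = "('n \<Rightarrow>\<^sub>0 nat) \<Rightarrow>\<^sub>0 complex"

definition poly_eval :: "'n::finite cpoly \<Rightarrow> complex ^ 'n \<Rightarrow> complex" where
  "poly_eval p z = (\<Sum>m\<in>Poly_Mapping.keys p.
     Poly_Mapping.lookup p m * (\<Prod>j\<in>UNIV. (z $ j) ^ Poly_Mapping.lookup m j))"

text \<open>The zero polynomial gets degree 0.\<close>

definition total_deg :: "'n::finite cpoly \<Rightarrow> nat" where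
  "total_deg p =
     Max (insert 0 ((\<lambda>m. \<Sum>j\<in>UNIV. Poly_Mapping.lookup m j) ` Poly_Mapping.keys p))"

text \<open>Meant for open \<open>S\<close>: the derivative exists in the real sense and is complex linear.\<close>

definition holomorphic_several :: "(complex ^ 'n::finite \<Rightarrow> complex) \<Rightarrow> (complex ^ 'n) set \<Rightarrow> bool" where
  "holomorphic_several f S \<longleftrightarrow>
     (\<forall>z\<in>S. \<exists>f'. (f has_derivative f') (at z) \<and> (\<forall>c v. f' (c *s v) = c * f' v))"

text \<open>A polynomial map to \<open>N\<close>-dimensional complex space is the list of its \<open>N\<close> components.
  Since fractions need not be in lowest terms, holomorphy of \<open>P/g\<close> on the ball means that each
  component extends holomorphically across the zeros of \<open>g\<close>.\<close>

definition sphere_map :: "'n::finite cpoly list \<Rightarrow> 'n cpoly \<Rightarrow> bool" where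
  "sphere_map P g \<longleftrightarrow>
     g \<noteq> 0 \<and>
     (\<forall>p\<in>set P. \<exists>f. holomorphic_several f (ball 0 1) \<and>
        (\<forall>z\<in>ball 0 1. poly_eval g z \<noteq> 0 \<longrightarrow> f z = poly_eval p z / poly_eval g z)) \<and>
     (\<forall>z\<in>sphere 0 1. (\<Sum>p\<leftarrow>P. (cmod (poly_eval p z))\<^sup>2) = (cmod (poly_eval g z))\<^sup>2)"

definition reduced :: "'n::finite cpoly list \<Rightarrow> 'n cpoly \<Rightarrow> bool" where
  "reduced P g \<longleftrightarrow> \<not> (\<exists>d. total_deg d > 0 \<and> d dvd g \<and> (\<forall>p\<in>set P. d dvd p))"

text \<open>The degree of the rational map \<open>P/g\<close> when this representation is reduced.\<close>

definition map_deg :: "'n::finite cpoly list \<Rightarrow> 'n cpoly \<Rightarrow> nat" where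
  "map_deg P g = Max (total_deg ` insert g (set P))"

definition pointed :: "'n::finite cpoly list \<Rightarrow> 'n cpoly \<Rightarrow> bool" where
  "pointed P g \<longleftrightarrow> poly_eval g 0 = 1 \<and> (\<forall>p\<in>set P. poly_eval p 0 = 0)"

definition quad_denom :: "('n::finite \<Rightarrow> real) \<Rightarrow> 'n cpoly" where
  "quad_denom \<sigma> =
     1 + (\<Sum>j\<in>UNIV. Poly_Mapping.single (Poly_Mapping.single j 2) (complex_of_real (\<sigma> j)))"

definition admits_cubic_map :: "'n::finite cpoly \<Rightarrow> bool" where
  "admits_cubic_map g \<longleftrightarrow>
     (\<exists>P. sphere_map P g \<and> reduced P g \<and> pointed P g \<and> map_deg P g = 3)"

end

theory Submission
  imports Defs
begin

text \<open>
  Write \<open>Q = \<Sum>\<^sub>j s\<^sub>j z\<^sub>j\<^sup>2\<close> and \<open>x\<^sub>j = |z\<^sub>j|\<^sup>2\<close>, so that the denominator is \<open>1 + Q\<close> and the sphere is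
  \<open>\<Sum>\<^sub>j x\<^sub>j = 1\<close>. On the sphere \<open>|1 + Q|\<^sup>2 = \<Sum>\<^sub>j x\<^sub>j (1 + 2 Re Q + |Q|\<^sup>2)\<close>. For weights \<open>0 < b\<^sub>j < 1\<close> and
  \<open>a\<^sub>j = 1 - b\<^sub>j\<close>, the components \<open>z\<^sub>j (a\<^sub>j + Q) / \<surd>a\<^sub>j\<close> have squared norm
  \<open>\<Sum>\<^sub>j x\<^sub>j (a\<^sub>j + 2 Re Q + |Q|\<^sup>2 / a\<^sub>j)\<close>: they absorb the whole mixed term \<open>2 Re Q\<close> and vanish at
  the origin. What is left, homogenised with \<open>\<Sum>\<^sub>j x\<^sub>j = 1\<close>, is the Hermitian form
  \<open>(\<Sum>\<^sub>j b\<^sub>j x\<^sub>j) (\<Sum>\<^sub>j x\<^sub>j)\<^sup>2 - \<Sum>\<^sub>j (b\<^sub>j / a\<^sub>j) |z\<^sub>j Q|\<^sup>2\<close> on cubic forms, and a sphere map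
  exists once this is a sum of squared norms of cubic forms.

  In the basis of monomials the first summand is diagonal. The cubic form \<open>z\<^sub>j Q\<close> only involves the
  monomials \<open>z\<^sub>j z\<^sub>k\<^sup>2\<close>, and for different \<open>j\<close> these sets of monomials are disjoint. So the form splits
  into one block for each \<open>j\<close>, a positive diagonal minus a form of rank one, and a positive diagonal on
  the monomials \<open>z\<^sub>i z\<^sub>j z\<^sub>k\<close> with distinct indices. A block is semidefinite exactly if
  \<open>(b\<^sub>j / a\<^sub>j) (s\<^sub>j\<^sup>2 / b\<^sub>j + \<Sum>\<^sub>k s\<^sub>k\<^sup>2 / (b\<^sub>j + 2 b\<^sub>k)) \<le> 1\<close>, where \<open>k\<close> runs over the indices
  different from \<open>j\<close>. Scaling \<open>b = \<epsilon> \<beta>\<close> with small \<open>\<epsilon>\<close> reduces this to the scale-invariant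
  condition \<open>s\<^sub>j\<^sup>2 + \<Sum>\<^sub>k s\<^sub>k\<^sup>2 \<beta>\<^sub>j / (\<beta>\<^sub>j + 2 \<beta>\<^sub>k) < 1\<close> of \<open>admits_cubic_map_of_ratios\<close>.

  Both existence claims follow by choosing \<open>\<beta>\<close>. If \<open>\<Sum>\<^sub>j \<surd>(1 - s\<^sub>j\<^sup>2) > n - 1\<close>, the choice
  \<open>\<beta>\<^sub>j = \<surd>(1 - s\<^sub>j\<^sup>2)\<close> works; if all \<open>s\<^sub>j\<close> equal \<open>s\<close>, the constant choice gives
  \<open>s\<^sup>2 (n + 2) / 3 < 1\<close>. For equal \<open>s\<^sub>j\<close> the first condition means \<open>s\<^sup>2 < (2 n - 1) / n\<^sup>2\<close> and the
  second one \<open>s\<^sup>2 < 3 / (n + 2)\<close>, which is weaker once \<open>n > 2\<close>, since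
  \<open>3 n\<^sup>2 - (2 n - 1) (n + 2) = (n - 1) (n - 2)\<close>.

  The representation is reduced because a common divisor of \<open>1 + Q\<close> and of \<open>z\<^sub>j (a\<^sub>j + Q)\<close> divides
  \<open>b\<^sub>j z\<^sub>j\<close>, hence every variable, hence \<open>Q\<close>, hence \<open>1\<close>. Its degree is three because the monomials
  \<open>z\<^sub>i z\<^sub>j z\<^sub>k\<close> with distinct indices occur with the coefficient \<open>\<surd>b\<^sub>i\<close>.
\<close>

section \<open>Evaluation and degree of polynomials\<close>

lemma poly_eval_superset:
  assumes "finite S" "Poly_Mapping.keys p \<subseteq> S"
  shows "poly_eval p z = (\<Sum>m\<in>S. Poly_Mapping.lookup p m *
    (\<Prod>j\<in>UNIV. (z $ j) ^ Poly_Mapping.lookup m j))"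
  unfolding poly_eval_def using assms
  by (intro sum.mono_neutral_left) (auto simp: in_keys_iff)

lemma poly_eval_zero [simp]: "poly_eval 0 z = 0"
  by (simp add: poly_eval_def)

lemma poly_eval_add [simp]: "poly_eval (p + q) z = poly_eval p z + poly_eval q z"
proof -
  let ?S = "Poly_Mapping.keys p \<union> Poly_Mapping.keys q"
  have "poly_eval r z = (\<Sum>m\<in>?S. Poly_Mapping.lookup r m *
      (\<Prod>j\<in>UNIV. (z $ j) ^ Poly_Mapping.lookup m j))" if "r \<in> {p, q, p + q}" for r
    using that Poly_Mapping.keys_add[of p q] by (intro poly_eval_superset) auto
  then show ?thesis
    by (simp add: lookup_add algebra_simps sum.distrib)
qed

lemma poly_eval_sum [simp]: "poly_eval (\<Sum>i\<in>I. p i) z = (\<Sum>i\<in>I. poly_eval (p i) z)"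
  by (induction I rule: infinite_finite_induct) auto

lemma poly_eval_single:
  "poly_eval (Poly_Mapping.single m c) z = c * (\<Prod>j\<in>UNIV. (z $ j) ^ Poly_Mapping.lookup m j)"
  by (simp add: poly_eval_def)

lemma poly_mapping_sum_singles:
  "p = (\<Sum>m\<in>Poly_Mapping.keys p. Poly_Mapping.single m (Poly_Mapping.lookup p m))"
proof (rule poly_mapping_eqI)
  fix k
  show "Poly_Mapping.lookup p k = Poly_Mapping.lookup
      (\<Sum>m\<in>Poly_Mapping.keys p. Poly_Mapping.single m (Poly_Mapping.lookup p m)) k"
    by (simp add: lookup_sum lookup_single when_def in_keys_iff)
qed

lemma poly_eval_mult [simp]: "poly_eval (p * q) z = poly_eval p z * poly_eval q z"
proof -
  have single: "poly_eval (Poly_Mapping.single m c * Poly_Mapping.single m' c') z =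
      poly_eval (Poly_Mapping.single m c) z * poly_eval (Poly_Mapping.single m' c') z" for m m' c c'
    by (simp add: mult_single poly_eval_single lookup_add power_add prod.distrib)
  have "poly_eval (p * q) z =
      poly_eval ((\<Sum>m\<in>Poly_Mapping.keys p. Poly_Mapping.single m (Poly_Mapping.lookup p m)) *
        (\<Sum>m\<in>Poly_Mapping.keys q. Poly_Mapping.single m (Poly_Mapping.lookup q m))) z"
    by (simp flip: poly_mapping_sum_singles)
  also have "\<dots> =
      poly_eval (\<Sum>m\<in>Poly_Mapping.keys p. Poly_Mapping.single m (Poly_Mapping.lookup p m)) z *
      poly_eval (\<Sum>m\<in>Poly_Mapping.keys q. Poly_Mapping.single m (Poly_Mapping.lookup q m)) z"
    by (simp add: sum_product single)
  finally show ?thesis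
    by (simp flip: poly_mapping_sum_singles)
qed

definition poly_const :: "complex \<Rightarrow> 'n::finite cpoly" where
  "poly_const c = Poly_Mapping.single 0 c"

definition poly_var :: "'n::finite \<Rightarrow> 'n cpoly" where
  "poly_var j = Poly_Mapping.single (Poly_Mapping.single j 1) 1"

lemma poly_eval_const [simp]: "poly_eval (poly_const c) z = c"
  by (simp add: poly_const_def poly_eval_single)

lemma poly_eval_one [simp]: "poly_eval 1 z = 1"
  by (simp add: poly_eval_single flip: single_one)

lemma poly_eval_var [simp]: "poly_eval (poly_var i) z = z $ i"
proof -
  have "(\<Prod>j\<in>UNIV. (z $ j) ^ (Poly_Mapping.lookup (Poly_Mapping.single i (1::nat)) j)) =
      (\<Prod>j\<in>UNIV. if j = i then z $ j else 1)"
    by (intro prod.cong) (auto simp: lookup_single)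
  then show ?thesis
    by (simp add: poly_var_def poly_eval_single)
qed

lemma poly_const_mult: "poly_const c * poly_const d = poly_const (c * d)"
  by (simp add: poly_const_def mult_single)

lemma poly_const_one [simp]: "poly_const 1 = 1"
  by (simp add: poly_const_def)

lemma poly_const_add: "poly_const (c + d) = poly_const c + poly_const d"
  by (simp add: poly_const_def single_add)

definition mono_deg :: "('n::finite \<Rightarrow>\<^sub>0 nat) \<Rightarrow> nat" where
  "mono_deg m = (\<Sum>j\<in>UNIV. Poly_Mapping.lookup m j)"

lemma mono_deg_zero [simp]: "mono_deg 0 = 0"
  by (simp add: mono_deg_def)

lemma mono_deg_add [simp]: "mono_deg (a + b) = mono_deg a + mono_deg b"
  by (simp add: mono_deg_def lookup_add sum.distrib)

lemma mono_deg_single [simp]: "mono_deg (Poly_Mapping.single j k) = k"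
  by (simp add: mono_deg_def lookup_single when_def)

lemma total_deg_le_iff: "total_deg p \<le> k \<longleftrightarrow> (\<forall>m\<in>Poly_Mapping.keys p. mono_deg m \<le> k)"
  by (auto simp: total_deg_def mono_deg_def)

lemma total_deg_add:
  assumes "total_deg p \<le> k" "total_deg q \<le> k"
  shows "total_deg (p + q) \<le> k"
  using assms Poly_Mapping.keys_add[of p q] by (auto simp: total_deg_le_iff)

lemma total_deg_sum:
  assumes "\<And>i. i \<in> I \<Longrightarrow> total_deg (p i) \<le> k"
  shows "total_deg (\<Sum>i\<in>I. p i) \<le> k"
  using assms
proof (induction I rule: infinite_finite_induct)
  case (insert i I)
  then show ?case by (simp add: total_deg_add)
qed (auto simp: total_deg_le_iff)

lemma total_deg_mult:
  assumes "total_deg p \<le> k" "total_deg q \<le> l"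
  shows "total_deg (p * q) \<le> k + l"
  unfolding total_deg_le_iff
proof
  fix m assume "m \<in> Poly_Mapping.keys (p * q)"
  then obtain a b where "m = a + b" "a \<in> Poly_Mapping.keys p" "b \<in> Poly_Mapping.keys q"
    using Poly_Mapping.keys_mult[of p q] by blast
  then show "mono_deg m \<le> k + l"
    using assms by (auto simp: total_deg_le_iff intro: add_mono)
qed

lemma total_deg_const: "total_deg (poly_const c) \<le> 0"
  unfolding total_deg_le_iff poly_const_def by simp

lemma total_deg_var: "total_deg (poly_var j) \<le> 1"
  unfolding total_deg_le_iff poly_var_def by simp

lemma total_deg_single:
  assumes "c \<noteq> 0"
  shows "total_deg (Poly_Mapping.single m c) = mono_deg m"
  using assms by (simp add: total_deg_def mono_deg_def)

section \<open>Units of the polynomial ring are constants\<close>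

text \<open>Positional notation: the exponent of the new variable is the last digit in a base that exceeds
  all exponents, and the weighted sum over the earlier variables is the leading part.\<close>

lemma separating_weights:
  fixes M :: "('n::finite \<Rightarrow>\<^sub>0 nat) set"
  assumes "finite M" "finite A"
  shows "\<exists>w :: 'n \<Rightarrow> nat. (\<forall>j. w j > 0) \<and> (\<forall>m\<in>M. \<forall>m'\<in>M.
    (\<Sum>j\<in>A. w j * Poly_Mapping.lookup m j) = (\<Sum>j\<in>A. w j * Poly_Mapping.lookup m' j) \<longrightarrow>
    (\<forall>j\<in>A. Poly_Mapping.lookup m j = Poly_Mapping.lookup m' j))"
  using assms(2)
proof (induction A)
  case empty
  show ?case by (intro exI[of _ "\<lambda>_. 1"]) auto
next
  case (insert i A)
  then obtain w :: "'n \<Rightarrow> nat" where pos: "\<And>j. w j > 0"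
    and w: "\<And>m m'. m \<in> M \<Longrightarrow> m' \<in> M \<Longrightarrow>
      (\<Sum>j\<in>A. w j * Poly_Mapping.lookup m j) = (\<Sum>j\<in>A. w j * Poly_Mapping.lookup m' j) \<Longrightarrow>
      \<forall>j\<in>A. Poly_Mapping.lookup m j = Poly_Mapping.lookup m' j"
    by metis
  define B where "B = Suc (\<Sum>m\<in>M. Poly_Mapping.lookup m i)"
  define w' where "w' = (\<lambda>j. if j = i then 1 else B * w j)"
  have less_B: "Poly_Mapping.lookup m i < B" if "m \<in> M" for m
    using member_le_sum[of m M "\<lambda>m. Poly_Mapping.lookup m i"] that assms(1) by (simp add: B_def)
  have split: "(\<Sum>j\<in>insert i A. w' j * Poly_Mapping.lookup m j) =
      Poly_Mapping.lookup m i + B * (\<Sum>j\<in>A. w j * Poly_Mapping.lookup m j)" for m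
  proof -
    have "(\<Sum>j\<in>A. w' j * Poly_Mapping.lookup m j) =
        (\<Sum>j\<in>A. B * (w j * Poly_Mapping.lookup m j))"
      using insert.hyps(2) by (intro sum.cong) (auto simp: w'_def)
    then show ?thesis
      using insert.hyps by (simp add: w'_def sum_distrib_left)
  qed
  show ?case
  proof (intro exI[of _ w'] conjI ballI impI)
    show "\<forall>j. w' j > 0"
      using pos by (simp add: w'_def B_def)
    fix m m' j
    assume m: "m \<in> M" "m' \<in> M" and j: "j \<in> insert i A"
      and "(\<Sum>j\<in>insert i A. w' j * Poly_Mapping.lookup m j) =
        (\<Sum>j\<in>insert i A. w' j * Poly_Mapping.lookup m' j)"
    then have eq: "Poly_Mapping.lookup m i + B * (\<Sum>j\<in>A. w j * Poly_Mapping.lookup m j) =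
        Poly_Mapping.lookup m' i + B * (\<Sum>j\<in>A. w j * Poly_Mapping.lookup m' j)"
      by (simp only: split)
    from arg_cong[OF eq, of "\<lambda>x. x mod B"] have i: "Poly_Mapping.lookup m i = Poly_Mapping.lookup m' i"
      using less_B m by simp
    moreover have "B > 0"
      by (simp add: B_def)
    ultimately have "\<forall>j\<in>A. Poly_Mapping.lookup m j = Poly_Mapping.lookup m' j"
      using eq by (intro w m) simp
    with i show "Poly_Mapping.lookup m j = Poly_Mapping.lookup m' j"
      using j by auto
  qed
qed

text \<open>The Kronecker substitution \<open>z\<^sub>j = t\<^sup>w\<close> with \<open>w = w j\<close>, as a polynomial in \<open>t\<close>.\<close>

definition weight_poly :: "('n::finite \<Rightarrow> nat) \<Rightarrow> 'n cpoly \<Rightarrow> complex poly" where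
  "weight_poly w p = (\<Sum>m\<in>Poly_Mapping.keys p.
     monom (Poly_Mapping.lookup p m) (\<Sum>j\<in>UNIV. w j * Poly_Mapping.lookup m j))"

lemma poly_weight_poly: "poly (weight_poly w p) t = poly_eval p (\<chi> j. t ^ w j)"
  by (simp add: weight_poly_def poly_eval_def poly_sum poly_monom power_sum power_mult)

text \<open>The claim is reduced to polynomials in one variable. The Kronecker substitution is multiplicative,
  because it is a restriction of evaluation to a curve; with
  separating weights it merges no two monomials of \<open>d\<close>. The image is a unit, so constant, and since
  all weights are positive \<open>d\<close> has no monomial besides \<open>1\<close>.\<close>

lemma total_deg_unit:
  fixes d :: "'n::finite cpoly"
  assumes "d dvd 1"
  shows "total_deg d = 0"
proof -
  obtain e where e: "d * e = 1"
    using assms by (metis dvdE)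
  obtain w :: "'n \<Rightarrow> nat" where pos: "\<And>j. w j > 0"
    and w: "\<And>m m'. m \<in> Poly_Mapping.keys d \<Longrightarrow> m' \<in> Poly_Mapping.keys d \<Longrightarrow>
      (\<Sum>j\<in>UNIV. w j * Poly_Mapping.lookup m j) = (\<Sum>j\<in>UNIV. w j * Poly_Mapping.lookup m' j) \<Longrightarrow>
      m = m'"
  proof -
    from separating_weights[OF finite_keys[of d] finite_class.finite_UNIV]
    obtain w :: "'n \<Rightarrow> nat" where w0: "\<forall>j. w j > 0"
      and *: "\<forall>m\<in>Poly_Mapping.keys d. \<forall>m'\<in>Poly_Mapping.keys d.
        (\<Sum>j\<in>UNIV. w j * Poly_Mapping.lookup m j) = (\<Sum>j\<in>UNIV. w j * Poly_Mapping.lookup m' j) \<longrightarrow>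
        (\<forall>j\<in>UNIV. Poly_Mapping.lookup m j = Poly_Mapping.lookup m' j)"
      by (elim exE conjE)
    show thesis
    proof (rule that[of w])
      fix j show "w j > 0"
        using w0 by blast
    next
      fix m m'
      assume "m \<in> Poly_Mapping.keys d" "m' \<in> Poly_Mapping.keys d"
        "(\<Sum>j\<in>UNIV. w j * Poly_Mapping.lookup m j) = (\<Sum>j\<in>UNIV. w j * Poly_Mapping.lookup m' j)"
      with * have "\<forall>j\<in>UNIV. Poly_Mapping.lookup m j = Poly_Mapping.lookup m' j"
        by blast
      then show "m = m'"
        by (intro poly_mapping_eqI) blast
    qed
  qed
  define wt where "wt = (\<lambda>m :: 'n \<Rightarrow>\<^sub>0 nat. \<Sum>j\<in>UNIV. w j * Poly_Mapping.lookup m j)"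
  have "poly (weight_poly w d * weight_poly w e) = poly 1"
  proof
    fix t
    have "poly (weight_poly w d * weight_poly w e) t = poly_eval (d * e) (\<chi> j. t ^ w j)"
      by (simp add: poly_weight_poly)
    then show "poly (weight_poly w d * weight_poly w e) t = poly 1 t"
      by (simp add: e)
  qed
  then have "weight_poly w d * weight_poly w e = 1"
    by (simp only: poly_eq_poly_eq_iff)
  then have deg: "degree (weight_poly w d) = 0"
    by (metis dvd_triv_left is_unit_poly_iff degree_pCons_0)
  have "mono_deg m \<le> 0" if m: "m \<in> Poly_Mapping.keys d" for m
  proof -
    have "coeff (weight_poly w d) (wt m) =
        (\<Sum>m'\<in>Poly_Mapping.keys d. if m' = m then Poly_Mapping.lookup d m' else 0)"
      unfolding weight_poly_def coeff_sum wt_def using w m by (intro sum.cong) auto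
    also have "\<dots> \<noteq> 0"
      using m by (simp add: in_keys_iff)
    finally have "wt m = 0"
      using deg le_degree by fastforce
    moreover have "w j \<noteq> 0" for j
      using pos[of j] by simp
    ultimately show ?thesis
      by (simp add: wt_def mono_deg_def)
  qed
  then show ?thesis
    using total_deg_le_iff[of d 0] by simp
qed

section \<open>Holomorphic functions\<close>

lemma holomorphic_several_const: "holomorphic_several (\<lambda>_. c) S"
  unfolding holomorphic_several_def by (auto intro!: exI[of _ "\<lambda>_. 0"])

lemma holomorphic_several_component: "holomorphic_several (\<lambda>z. z $ j) S"
  unfolding holomorphic_several_def
  by (auto intro!: exI[of _ "\<lambda>z. z $ j"] bounded_linear.has_derivative[OF bounded_linear_vec_nth]
      has_derivative_ident)

lemma holomorphic_several_add:
  assumes "holomorphic_several f S" "holomorphic_several g S"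
  shows "holomorphic_several (\<lambda>z. f z + g z) S"
  unfolding holomorphic_several_def
proof
  fix z assume z: "z \<in> S"
  obtain f' g' where "(f has_derivative f') (at z)" "\<forall>c v. f' (c *s v) = c * f' v"
    "(g has_derivative g') (at z)" "\<forall>c v. g' (c *s v) = c * g' v"
    using assms z unfolding holomorphic_several_def by meson
  then show "\<exists>h'. ((\<lambda>z. f z + g z) has_derivative h') (at z) \<and> (\<forall>c v. h' (c *s v) = c * h' v)"
    by (intro exI[of _ "\<lambda>v. f' v + g' v"]) (auto intro!: derivative_intros simp: algebra_simps)
qed

lemma holomorphic_several_mult:
  assumes "holomorphic_several f S" "holomorphic_several g S"
  shows "holomorphic_several (\<lambda>z. f z * g z) S"
  unfolding holomorphic_several_def
proof
  fix z assume z: "z \<in> S"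
  obtain f' g' where "(f has_derivative f') (at z)" "\<forall>c v. f' (c *s v) = c * f' v"
    "(g has_derivative g') (at z)" "\<forall>c v. g' (c *s v) = c * g' v"
    using assms z unfolding holomorphic_several_def by meson
  then show "\<exists>h'. ((\<lambda>z. f z * g z) has_derivative h') (at z) \<and> (\<forall>c v. h' (c *s v) = c * h' v)"
    by (intro exI[of _ "\<lambda>v. f z * g' v + f' v * g z"])
      (auto intro!: derivative_intros simp: algebra_simps)
qed

lemma holomorphic_several_divide:
  assumes "holomorphic_several f S" "holomorphic_several g S" "\<And>z. z \<in> S \<Longrightarrow> g z \<noteq> 0"
  shows "holomorphic_several (\<lambda>z. f z / g z) S"
  unfolding holomorphic_several_def
proof
  fix z assume z: "z \<in> S"
  obtain f' g' where "(f has_derivative f') (at z)" "\<forall>c v. f' (c *s v) = c * f' v"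
    "(g has_derivative g') (at z)" "\<forall>c v. g' (c *s v) = c * g' v"
    using assms(1,2) z unfolding holomorphic_several_def by meson
  then show "\<exists>h'. ((\<lambda>z. f z / g z) has_derivative h') (at z) \<and> (\<forall>c v. h' (c *s v) = c * h' v)"
    using assms(3)[OF z]
    by (intro exI[of _ "\<lambda>v. (f' v * g z - f z * g' v) / (g z * g z)"])
      (auto intro!: has_derivative_divide' simp: divide_simps, auto simp: algebra_simps)
qed

lemma holomorphic_several_sum:
  assumes "\<And>i. i \<in> I \<Longrightarrow> holomorphic_several (f i) S"
  shows "holomorphic_several (\<lambda>z. \<Sum>i\<in>I. f i z) S"
  using assms
  by (induction I rule: infinite_finite_induct)
    (auto intro: holomorphic_several_add holomorphic_several_const)

lemma holomorphic_several_prod: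
  assumes "\<And>i. i \<in> I \<Longrightarrow> holomorphic_several (f i) S"
  shows "holomorphic_several (\<lambda>z. \<Prod>i\<in>I. f i z) S"
  using assms
  by (induction I rule: infinite_finite_induct)
    (auto intro: holomorphic_several_mult holomorphic_several_const)

lemma holomorphic_several_power:
  assumes "holomorphic_several f S"
  shows "holomorphic_several (\<lambda>z. f z ^ k) S"
  using holomorphic_several_prod[of "{..<k}" "\<lambda>_. f" S] assms by simp

lemma holomorphic_several_poly_eval: "holomorphic_several (\<lambda>z. poly_eval p z) S"
  unfolding poly_eval_def
  by (intro holomorphic_several_sum holomorphic_several_mult holomorphic_several_const
      holomorphic_several_prod holomorphic_several_power holomorphic_several_component)

section \<open>Two Hermitian identities\<close>

text \<open>A positive diagonal form minus a rank-one form is a sum of squares as soon as the rank-one part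
  has norm at most one in the diagonal metric. Up to the diagonal scaling, the square root is the
  identity minus a multiple of the orthogonal projection; with \<open>W\<close> for the sum of the \<open>s\<^sub>k\<^sup>2 / d\<^sub>k\<close>,
  the coefficient \<open>l\<close> solves \<open>l\<^sup>2 W - 2 l = - c\<close>, written so that \<open>W = 0\<close> is included.\<close>

lemma weighted_norm_minus_rank_one:
  fixes d s :: "'i \<Rightarrow> real" and m :: "'i \<Rightarrow> complex"
  assumes d: "\<And>k. k \<in> I \<Longrightarrow> d k > 0"
    and c: "0 \<le> c" "c * (\<Sum>k\<in>I. (s k)\<^sup>2 / d k) \<le> 1"
    and l: "l = c / (1 + sqrt (1 - c * (\<Sum>k\<in>I. (s k)\<^sup>2 / d k)))"
    and S: "S = (\<Sum>k\<in>I. complex_of_real (s k) * m k)"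
  shows "(\<Sum>k\<in>I. (cmod (complex_of_real (sqrt (d k)) * m k - complex_of_real (l * s k / sqrt (d k)) * S))\<^sup>2)
    = (\<Sum>k\<in>I. d k * (cmod (m k))\<^sup>2) - c * (cmod S)\<^sup>2"
proof -
  define W where "W = (\<Sum>k\<in>I. (s k)\<^sup>2 / d k)"
  define r where "r = sqrt (1 - c * W)"
  have r: "r \<ge> 0" "c * W = 1 - r\<^sup>2"
    using c by (auto simp: r_def W_def)
  have l': "l = c / (1 + r)"
    by (simp add: l r_def W_def)
  have "l\<^sup>2 * W = c * (c * W) / (1 + r)\<^sup>2"
    by (simp add: l' power_divide power2_eq_square)
  also have "\<dots> = c * (1 - r) / (1 + r)"
    unfolding r(2) using r(1) by (simp add: divide_simps) (simp add: power2_eq_square algebra_simps)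
  finally have lW: "l\<^sup>2 * W - 2 * l = - c"
    using r(1) by (simp add: l' divide_simps) (simp add: algebra_simps)
  have "(cmod (complex_of_real (sqrt (d k)) * m k - complex_of_real (l * s k / sqrt (d k)) * S))\<^sup>2 =
      d k * (cmod (m k))\<^sup>2 - 2 * l * Re (complex_of_real (s k) * m k * cnj S)
      + l\<^sup>2 * (cmod S)\<^sup>2 * ((s k)\<^sup>2 / d k)" if "k \<in> I" for k
  proof -
    have e1: "(cmod (u - v))\<^sup>2 = (cmod u)\<^sup>2 - 2 * Re (u * cnj v) + (cmod v)\<^sup>2" for u v
      unfolding cmod_power2 by (simp add: power2_eq_square algebra_simps)
    have e2: "complex_of_real (sqrt (d k)) * m k * cnj (complex_of_real (l * s k / sqrt (d k)) * S)
        = complex_of_real l * (complex_of_real (s k) * m k * cnj S)"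
      using d[OF that] by (simp add: field_simps)
    have e3: "Re (complex_of_real l * (complex_of_real (s k) * m k * cnj S)) =
        l * Re (complex_of_real (s k) * m k * cnj S)"
      by simp
    have e4: "(cmod (complex_of_real (l * s k / sqrt (d k)) * S))\<^sup>2 =
        l\<^sup>2 * (cmod S)\<^sup>2 * ((s k)\<^sup>2 / d k)"
      using d[OF that] by (simp add: norm_mult norm_divide power_mult_distrib power_divide)
    have e5: "(cmod (complex_of_real (sqrt (d k)) * m k))\<^sup>2 = d k * (cmod (m k))\<^sup>2"
      using d[OF that] by (simp add: norm_mult power_mult_distrib)
    show ?thesis
      unfolding e1 e2 e3 e4 e5 by (simp only: mult.assoc)
  qed
  then have "(\<Sum>k\<in>I. (cmod (complex_of_real (sqrt (d k)) * m k - complex_of_real (l * s k / sqrt (d k)) * S))\<^sup>2)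
      = (\<Sum>k\<in>I. d k * (cmod (m k))\<^sup>2 - 2 * l * Re (complex_of_real (s k) * m k * cnj S)
          + l\<^sup>2 * (cmod S)\<^sup>2 * ((s k)\<^sup>2 / d k))"
    by (intro sum.cong refl)
  also have "\<dots>= (\<Sum>k\<in>I. d k * (cmod (m k))\<^sup>2) - 2 * l * (\<Sum>k\<in>I. Re (complex_of_real (s k) * m k * cnj S))
        + l\<^sup>2 * (cmod S)\<^sup>2 * W"
    by (simp only: sum.distrib sum_subtractf sum_distrib_left W_def)
  also have "(\<Sum>k\<in>I. Re (complex_of_real (s k) * m k * cnj S)) = Re (S * cnj S)"
    by (simp only: S sum_distrib_right Re_sum)
  also have "Re (S * cnj S) = (cmod S)\<^sup>2"
    by (simp add: complex_mult_cnj cmod_power2)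
  also have "(\<Sum>k\<in>I. d k * (cmod (m k))\<^sup>2) - 2 * l * (cmod S)\<^sup>2 + l\<^sup>2 * (cmod S)\<^sup>2 * W =
      (\<Sum>k\<in>I. d k * (cmod (m k))\<^sup>2) + (l\<^sup>2 * W - 2 * l) * (cmod S)\<^sup>2"
    by (simp add: algebra_simps)
  finally show ?thesis
    by (simp add: lW)
qed

text \<open>The coefficient of \<open>x\<^sub>j x\<^sub>k\<^sup>2\<close> in \<open>(\<Sum>\<^sub>i b\<^sub>i x\<^sub>i) (\<Sum>\<^sub>i x\<^sub>i)\<^sup>2\<close>.\<close>

definition cubic_weight :: "('n \<Rightarrow> real) \<Rightarrow> 'n \<Rightarrow> 'n \<Rightarrow> real" where
  "cubic_weight b j k = (if k = j then b j else b j + 2 * b k)"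

definition distinct_triples :: "('n \<times> 'n \<times> 'n) set" where
  "distinct_triples = {(i, j, k). i \<noteq> j \<and> i \<noteq> k \<and> j \<noteq> k}"

text \<open>The triple sum over \<open>b\<^sub>i x\<^sub>i x\<^sub>j x\<^sub>k\<close> is split by the coincidences among the indices. The triples
  with distinct indices are kept as they are, since each of them gives one component of the map.\<close>

lemma weighted_cubic_expansion:
  fixes b x :: "'n::finite \<Rightarrow> real"
  shows "(\<Sum>j\<in>UNIV. b j * x j) * (\<Sum>j\<in>UNIV. x j)\<^sup>2 =
    (\<Sum>j\<in>UNIV. \<Sum>k\<in>UNIV. cubic_weight b j k * (x j * (x k)\<^sup>2)) +
    (\<Sum>(i, j, k)\<in>distinct_triples. b i * (x i * x j * x k))"
proof -
  define f where "f = (\<lambda>i j k. b i * x i * (x j * x k))"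
  have "(\<Sum>j\<in>UNIV. b j * x j) * (\<Sum>j\<in>UNIV. x j)\<^sup>2 = (\<Sum>i\<in>UNIV. \<Sum>j\<in>UNIV. \<Sum>k\<in>UNIV. f i j k)"
    by (simp add: power2_eq_square f_def flip: sum_distrib_left sum_distrib_right)
  also have "\<dots> = (\<Sum>i\<in>UNIV. \<Sum>j\<in>UNIV. \<Sum>k\<in>UNIV.
      (if i \<noteq> j \<and> i \<noteq> k \<and> j \<noteq> k then f i j k else 0) + (if k = j then f i j j else 0)
      + (if j = i then (if k \<noteq> i then f i i k else 0) else 0)
      + (if k = i then (if j \<noteq> i then f i j i else 0) else 0))"
    by (intro sum.cong) auto
  also have "\<dots> = (\<Sum>i\<in>UNIV. \<Sum>j\<in>UNIV. \<Sum>k\<in>UNIV. if i \<noteq> j \<and> i \<noteq> k \<and> j \<noteq> k then f i j k else 0)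
      + (\<Sum>i\<in>UNIV. \<Sum>j\<in>UNIV. f i j j)
      + (\<Sum>i\<in>UNIV. \<Sum>k\<in>UNIV. if k \<noteq> i then f i i k else 0)
      + (\<Sum>i\<in>UNIV. \<Sum>j\<in>UNIV. if j \<noteq> i then f i j i else 0)"
  proof -
    have "(\<Sum>j\<in>UNIV. \<Sum>k\<in>UNIV. if j = i then (if k \<noteq> i then f i i k else 0) else 0) =
        (\<Sum>k\<in>UNIV. if k \<noteq> i then f i i k else 0)" for i
      by (subst sum.swap) simp
    then show ?thesis
      by (simp add: sum.distrib)
  qed
  also have "(\<Sum>i\<in>UNIV. \<Sum>j\<in>UNIV. \<Sum>k\<in>UNIV. if i \<noteq> j \<and> i \<noteq> k \<and> j \<noteq> k then f i j k else 0) =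
      (\<Sum>(i, j, k)\<in>distinct_triples. f i j k)"
  proof -
    have "(\<Sum>(i, j, k)\<in>distinct_triples. f i j k) =
        (\<Sum>(i, j, k)\<in>UNIV. if i \<noteq> j \<and> i \<noteq> k \<and> j \<noteq> k then f i j k else 0)"
      by (rule sum.mono_neutral_cong_left) (auto simp: distinct_triples_def)
    then show ?thesis
      by (simp add: sum.cartesian_product)
  qed
  also have "(\<Sum>i\<in>UNIV. \<Sum>k\<in>UNIV. if k \<noteq> i then f i i k else 0) =
      (\<Sum>k\<in>UNIV. \<Sum>i\<in>UNIV. if k \<noteq> i then f i i k else 0)"
    by (rule sum.swap)
  also have "(\<Sum>i\<in>UNIV. \<Sum>j\<in>UNIV. if j \<noteq> i then f i j i else 0) =
      (\<Sum>j\<in>UNIV. \<Sum>i\<in>UNIV. if j \<noteq> i then f i j i else 0)"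
    by (rule sum.swap)
  finally have "(\<Sum>j\<in>UNIV. b j * x j) * (\<Sum>j\<in>UNIV. x j)\<^sup>2 = (\<Sum>(i, j, k)\<in>distinct_triples. f i j k) +
      (\<Sum>j\<in>UNIV. \<Sum>k\<in>UNIV. f j k k + (if j \<noteq> k then f k k j else 0) + (if j \<noteq> k then f k j k else 0))"
    by (simp add: sum.distrib)
  also have "(\<Sum>j\<in>UNIV. \<Sum>k\<in>UNIV. f j k k + (if j \<noteq> k then f k k j else 0) + (if j \<noteq> k then f k j k else 0)) =
      (\<Sum>j\<in>UNIV. \<Sum>k\<in>UNIV. cubic_weight b j k * (x j * (x k)\<^sup>2))"
    by (intro sum.cong) (auto simp: f_def cubic_weight_def power2_eq_square algebra_simps)
  finally show ?thesis
    by (simp add: f_def mult.assoc)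
qed

section \<open>Construction of the map\<close>

definition quad_form :: "('n::finite \<Rightarrow> real) \<Rightarrow> 'n cpoly" where
  "quad_form s = (\<Sum>k\<in>UNIV. poly_const (complex_of_real (s k)) * (poly_var k * poly_var k))"

lemma quad_denom_eq: "quad_denom s = 1 + quad_form s"
  by (simp add: quad_denom_def quad_form_def poly_const_def poly_var_def mult_single numeral_2_eq_2
      flip: single_add)

lemma poly_eval_quad_form:
  "poly_eval (quad_form s) z = (\<Sum>k\<in>UNIV. complex_of_real (s k) * (z $ k)\<^sup>2)"
  by (simp add: quad_form_def power2_eq_square)

lemma total_deg_quad_form: "total_deg (quad_form s) \<le> 2"
  unfolding quad_form_def
  by (intro total_deg_sum order_trans[OF total_deg_mult[OF total_deg_const
        total_deg_mult[OF total_deg_var total_deg_var]]]) simp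

lemma norm_vec_power2: "(norm (z :: complex ^ 'n::finite))\<^sup>2 = (\<Sum>k\<in>UNIV. (cmod (z $ k))\<^sup>2)"
  by (simp add: norm_vec_def L2_set_def sum_nonneg)

text \<open>On the ball \<open>|Q| \<le> \<Sum>\<^sub>k |z\<^sub>k|\<^sup>2 < 1\<close>.\<close>

lemma quad_denom_nonzero_in_ball:
  assumes s: "\<And>k. 0 \<le> s k" "\<And>k. s k \<le> 1" and z: "z \<in> ball 0 1"
  shows "poly_eval (quad_denom s) z \<noteq> 0"
proof
  assume "poly_eval (quad_denom s) z = 0"
  then have "poly_eval (quad_form s) z = - 1"
    by (simp add: quad_denom_eq eq_neg_iff_add_eq_0 add.commute)
  then have "1 = cmod (\<Sum>k\<in>UNIV. complex_of_real (s k) * (z $ k)\<^sup>2)"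
    by (simp add: poly_eval_quad_form)
  also have "\<dots> \<le> (\<Sum>k\<in>UNIV. cmod (complex_of_real (s k) * (z $ k)\<^sup>2))"
    by (rule norm_sum)
  also have "\<dots> \<le> (\<Sum>k\<in>UNIV. (cmod (z $ k))\<^sup>2)"
    using s by (intro sum_mono) (simp add: norm_mult norm_power mult_left_le_one_le)
  also have "\<dots> = (norm z)\<^sup>2"
    by (simp add: norm_vec_power2)
  also have "\<dots> < 1"
    using z by (simp add: power_less_one_iff)
  finally show False
    by simp
qed

text \<open>The hypothesis \<open>schur\<close> says that, after the components \<open>A j\<close> have absorbed the mixed terms, the
  remaining Hermitian form on cubic forms is positive semidefinite. The components \<open>B (j, k)\<close> realise
  its block \<open>j\<close>, and the components \<open>C (i, j, k)\<close> its diagonal part.\<close>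

lemma admits_cubic_map_of_weights:
  fixes s b :: "'n::finite \<Rightarrow> real"
  assumes n: "CARD('n) > 2"
    and s: "\<And>j. 0 \<le> s j" "\<And>j. s j < 1"
    and b: "\<And>j. 0 < b j" "\<And>j. b j < 1"
    and schur: "\<And>j. b j / (1 - b j) * (\<Sum>k\<in>UNIV. (s k)\<^sup>2 / cubic_weight b j k) \<le> 1"
  shows "admits_cubic_map (quad_denom s)"
proof -
  define g where "g = quad_denom s"
  define Q where "Q = quad_form s"
  define a where "a = (\<lambda>j. 1 - b j)"
  define d where "d = cubic_weight b"
  define c where "c = (\<lambda>j. b j / a j)"
  define l where "l = (\<lambda>j. c j / (1 + sqrt (1 - c j * (\<Sum>k\<in>UNIV. (s k)\<^sup>2 / d j k))))"
  define A where "A = (\<lambda>j. poly_const (complex_of_real (1 / sqrt (a j))) *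
    (poly_var j * (poly_const (complex_of_real (a j)) + Q)))"
  define B where "B = (\<lambda>(j, k). poly_const (complex_of_real (sqrt (d j k))) *
      (poly_var j * (poly_var k * poly_var k)) +
    poly_const (complex_of_real (- (l j * s k / sqrt (d j k)))) * (poly_var j * Q))"
  define C where "C = (\<lambda>(i, j, k). poly_const (complex_of_real (sqrt (b i))) *
    (poly_var i * (poly_var j * poly_var k)))"
  obtain js :: "'n list" where js: "set js = UNIV" "distinct js"
    using finite_distinct_list[of "UNIV :: 'n set"] by auto
  obtain ps :: "('n \<times> 'n) list" where ps: "set ps = UNIV" "distinct ps"
    using finite_distinct_list[of "UNIV :: ('n \<times> 'n) set"] by auto
  obtain ts :: "('n \<times> 'n \<times> 'n) list" where ts: "set ts = distinct_triples" "distinct ts"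
    using finite_distinct_list[of "distinct_triples :: ('n \<times> 'n \<times> 'n) set"] by auto
  define P where "P = map A js @ map B ps @ map C ts"
  have set_P: "set P = range A \<union> range B \<union> C ` distinct_triples"
    by (auto simp: P_def js ps ts)

  have a: "0 < a j" "a j < 1" for j
    using b[of j] by (auto simp: a_def)
  have d: "0 < d j k" for j k
    using b(1)[of j] b(1)[of k] by (auto simp: d_def cubic_weight_def)
  have c: "0 \<le> c j" for j
    using a[of j] b[of j] by (simp add: c_def)
  have cW: "c j * (\<Sum>k\<in>UNIV. (s k)\<^sup>2 / d j k) \<le> 1" for j
    using schur[of j] by (simp add: c_def a_def d_def)

  have g0: "poly_eval g 0 = 1"
    by (simp add: g_def quad_denom_eq poly_eval_quad_form)
  then have g: "g \<noteq> 0"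
    by auto

  have "(\<Sum>p\<leftarrow>P. (cmod (poly_eval p z))\<^sup>2) = (cmod (poly_eval g z))\<^sup>2" if z: "z \<in> sphere 0 1" for z
  proof -
    define q where "q = poly_eval Q z"
    define x where "x = (\<lambda>j. (cmod (z $ j))\<^sup>2)"
    have x: "(\<Sum>j\<in>UNIV. x j) = 1"
      using z norm_vec_power2[of z] by (simp add: x_def)
    have evalA: "(cmod (poly_eval (A j) z))\<^sup>2 = a j * x j + 2 * Re q * x j + (cmod q)\<^sup>2 * (x j / a j)" for j
    proof -
      have "(cmod (poly_eval (A j) z))\<^sup>2 = x j * (cmod (complex_of_real (a j) + q))\<^sup>2 / a j"
        using a[of j] by (simp add: A_def q_def x_def norm_mult norm_divide power_mult_distrib power_divide)
      also have "(cmod (complex_of_real (a j) + q))\<^sup>2 = (a j)\<^sup>2 + 2 * a j * Re q + (cmod q)\<^sup>2"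
        unfolding cmod_power2 by (simp add: power2_eq_square algebra_simps)
      finally show ?thesis
        using a[of j] by (simp add: field_simps power2_eq_square)
    qed
    have evalB: "(\<Sum>k\<in>UNIV. (cmod (poly_eval (B (j, k)) z))\<^sup>2) =
        (\<Sum>k\<in>UNIV. d j k * (x j * (x k)\<^sup>2)) - (cmod q)\<^sup>2 * (x j / a j - x j)" for j
    proof -
      have S: "z $ j * q = (\<Sum>k\<in>UNIV. complex_of_real (s k) * (z $ j * (z $ k)\<^sup>2))"
        by (simp add: q_def Q_def poly_eval_quad_form sum_distrib_left algebra_simps)
      have "(\<Sum>k\<in>UNIV. (cmod (poly_eval (B (j, k)) z))\<^sup>2) =
          (\<Sum>k\<in>UNIV. (cmod (complex_of_real (sqrt (d j k)) * (z $ j * (z $ k)\<^sup>2) -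
            complex_of_real (l j * s k / sqrt (d j k)) * (z $ j * q)))\<^sup>2)"
        by (simp add: B_def q_def power2_eq_square)
      also have "\<dots> = (\<Sum>k\<in>UNIV. d j k * (cmod (z $ j * (z $ k)\<^sup>2))\<^sup>2) - c j * (cmod (z $ j * q))\<^sup>2"
        by (rule weighted_norm_minus_rank_one) (use d c cW S in \<open>auto simp: l_def\<close>)
      also have "\<dots> = (\<Sum>k\<in>UNIV. d j k * (x j * (x k)\<^sup>2)) - c j * (x j * (cmod q)\<^sup>2)"
        by (simp add: x_def norm_mult norm_power power_mult_distrib)
      also have "c j * (x j * (cmod q)\<^sup>2) = (cmod q)\<^sup>2 * (x j / a j - x j)"
        using a[of j] by (simp add: c_def a_def field_simps)
      finally show ?thesis .
    qed
    have evalC: "(cmod (poly_eval (C t) z))\<^sup>2 = (case t of (i, j, k) \<Rightarrow> b i * (x i * x j * x k))" for t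
      using b(1) by (simp add: C_def x_def norm_mult power_mult_distrib less_imp_le split: prod.split)
    have "(\<Sum>p\<leftarrow>P. (cmod (poly_eval p z))\<^sup>2) = (\<Sum>j\<in>UNIV. (cmod (poly_eval (A j) z))\<^sup>2) +
        (\<Sum>j\<in>UNIV. \<Sum>k\<in>UNIV. (cmod (poly_eval (B (j, k)) z))\<^sup>2) +
        (\<Sum>t\<in>distinct_triples. (cmod (poly_eval (C t) z))\<^sup>2)"
      by (simp add: P_def js ps ts sum_list_distinct_conv_sum_set o_def sum.cartesian_product)
    also have "\<dots> = (\<Sum>j\<in>UNIV. a j * x j + 2 * Re q * x j + (cmod q)\<^sup>2 * x j) +
        ((\<Sum>j\<in>UNIV. \<Sum>k\<in>UNIV. d j k * (x j * (x k)\<^sup>2)) +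
         (\<Sum>(i, j, k)\<in>distinct_triples. b i * (x i * x j * x k)))"
      by (simp add: evalA evalB evalC sum.distrib sum_subtractf right_diff_distrib)
    also have "\<dots> = (\<Sum>j\<in>UNIV. a j * x j + 2 * Re q * x j + (cmod q)\<^sup>2 * x j) + (\<Sum>j\<in>UNIV. b j * x j)"
      using weighted_cubic_expansion[of b x] by (simp add: d_def x)
    also have "\<dots> = (\<Sum>j\<in>UNIV. (1 + 2 * Re q + (cmod q)\<^sup>2) * x j)"
      unfolding sum.distrib[symmetric] by (intro sum.cong) (auto simp: a_def algebra_simps)
    also have "\<dots> = 1 + 2 * Re q + (cmod q)\<^sup>2"
      by (simp add: x flip: sum_distrib_left)
    also have "\<dots> = (cmod (1 + q))\<^sup>2"
      unfolding cmod_power2 by (simp add: power2_eq_square algebra_simps)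
    finally show ?thesis
      by (simp add: g_def quad_denom_eq q_def Q_def)
  qed
  moreover have "holomorphic_several (\<lambda>z. poly_eval p z / poly_eval g z) (ball 0 1)" for p
    unfolding g_def using s
    by (intro holomorphic_several_divide holomorphic_several_poly_eval quad_denom_nonzero_in_ball)
      (auto intro: less_imp_le)
  ultimately have "sphere_map P g"
    unfolding sphere_map_def using g by blast

  moreover have "reduced P g"
    unfolding reduced_def
  proof (intro notI, elim exE conjE)
    fix e assume e: "total_deg e > 0" "e dvd g" "\<forall>p\<in>set P. e dvd p"
    \<comment> \<open>\<open>A j\<close> is, up to a constant, \<open>z\<^sub>j (g - b\<^sub>j)\<close>.\<close>
    have "e dvd poly_var j" for j
    proof -
      have "e dvd A j"
        using e(3) by (auto simp: set_P)
      then have "e dvd poly_const (complex_of_real (sqrt (a j))) * A j"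
        by simp
      also have "poly_const (complex_of_real (sqrt (a j))) * A j =
          poly_var j * (poly_const (complex_of_real (a j)) + Q)"
        using a[of j] by (simp add: A_def poly_const_mult flip: mult.assoc of_real_mult)
      also have "\<dots> = poly_var j * g - poly_const (complex_of_real (b j)) * poly_var j"
      proof -
        have "1 = poly_const (complex_of_real (a j)) + poly_const (complex_of_real (b j))"
          by (simp add: a_def flip: poly_const_add)
        then have "poly_var j = poly_var j * poly_const (complex_of_real (a j)) +
            poly_var j * poly_const (complex_of_real (b j))"
          by (metis distrib_left mult_1_right)
        then show ?thesis
          by (simp add: g_def quad_denom_eq Q_def algebra_simps)
      qed
      finally have "e dvd poly_const (complex_of_real (b j)) * poly_var j"
        using e(2) by (metis dvd_diff_right_iff dvd_mult)
      then have "e dvd poly_const (complex_of_real (1 / b j)) *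
          (poly_const (complex_of_real (b j)) * poly_var j)"
        by simp
      then show ?thesis
        using b[of j] by (simp add: poly_const_mult flip: mult.assoc of_real_mult)
    qed
    then have "e dvd quad_form s"
      by (auto simp: quad_form_def intro!: dvd_sum)
    moreover have "e dvd 1 + quad_form s"
      using e(2) by (simp add: g_def quad_denom_eq)
    ultimately have "e dvd 1"
      using dvd_add_left_iff by blast
    then show False
      using e(1) total_deg_unit by fastforce
  qed

  moreover have "pointed P g"
    by (auto simp: pointed_def g0 set_P A_def B_def C_def split: prod.splits)

  moreover have "map_deg P g = 3"
    unfolding map_deg_def
  proof (rule Max_eqI)
    have Q: "total_deg Q \<le> 2"
      by (simp add: Q_def total_deg_quad_form)
    have deg_const: "total_deg (poly_const u * p) \<le> k" if "total_deg p \<le> k" for u k and p :: "'n cpoly"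
      using total_deg_mult[OF total_deg_const that] by simp
    have deg_var: "total_deg (poly_var j * p) \<le> 3" if "total_deg p \<le> 2" for j and p :: "'n cpoly"
      using total_deg_mult[OF total_deg_var[of j] that] by simp
    have deg_vars: "total_deg (poly_var j * poly_var k) \<le> 2" for j k :: 'n
      using total_deg_mult[OF total_deg_var[of j] total_deg_var[of k]] by simp
    have "total_deg (poly_const u :: 'n cpoly) \<le> 2" for u
      using order_trans[OF total_deg_const, of 2] by simp
    moreover have "total_deg (1 :: 'n cpoly) \<le> 3"
      by (simp add: total_deg_le_iff)
    ultimately have "total_deg (1 + Q) \<le> 3" "total_deg (A j) \<le> 3" "total_deg (B (j, k)) \<le> 3"
      "total_deg (C (i, j, k)) \<le> 3" for i j k
      unfolding A_def B_def C_def prod.case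
      using Q
      by (auto intro!: deg_const total_deg_add deg_var deg_vars)
    then show "y \<le> 3" if "y \<in> total_deg ` insert g (set P)" for y
      using that by (auto simp: set_P g_def quad_denom_eq Q_def)
    obtain S :: "'n set" where "card S = 3"
      using n obtain_subset_with_card_n[of 3 "UNIV :: 'n set"] by auto
    then obtain i j k :: 'n where "i \<noteq> j" "i \<noteq> k" "j \<noteq> k"
      by (auto simp: card_3_iff)
    then have t: "(i, j, k) \<in> distinct_triples"
      by (simp add: distinct_triples_def)
    have "total_deg (C (i, j, k)) = 3"
      using b(1)[of i] unfolding C_def poly_const_def poly_var_def
      by (simp add: mult_single total_deg_single)
    then show "3 \<in> total_deg ` insert g (set P)"
      using t by (auto simp: set_P image_iff intro!: bexI[of _ "C (i, j, k)"])
  qed auto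

  ultimately show ?thesis
    unfolding admits_cubic_map_def g_def by blast
qed

section \<open>Choice of the weights\<close>

lemma cubic_weight_pos:
  assumes "\<And>j. b j > 0"
  shows "cubic_weight b j k > 0"
  using assms[of j] assms[of k] by (simp add: cubic_weight_def)

text \<open>The ratio \<open>\<beta> j / cubic_weight \<beta> j k\<close> does not change when \<open>\<beta>\<close> is scaled. With \<open>b = \<epsilon> \<beta>\<close> the
  left side of \<open>schur\<close> is \<open>L j / (1 - \<epsilon> * \<beta> j)\<close>, which is at most one for small \<open>\<epsilon>\<close>.\<close>

lemma admits_cubic_map_of_ratios:
  fixes s \<beta> :: "'n::finite \<Rightarrow> real"
  assumes n: "CARD('n) > 2"
    and s: "\<And>j. 0 \<le> s j" "\<And>j. s j < 1"
    and \<beta>: "\<And>j. 0 < \<beta> j"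
    and less: "\<And>j. (\<Sum>k\<in>UNIV. (s k)\<^sup>2 * (\<beta> j / cubic_weight \<beta> j k)) < 1"
  shows "admits_cubic_map (quad_denom s)"
proof -
  define L where "L = (\<lambda>j. \<Sum>k\<in>UNIV. (s k)\<^sup>2 * (\<beta> j / cubic_weight \<beta> j k))"
  have L: "0 \<le> L j" "L j < 1" for j
  proof -
    show "0 \<le> L j"
      unfolding L_def using \<beta> cubic_weight_pos[OF \<beta>]
      by (intro sum_nonneg mult_nonneg_nonneg divide_nonneg_pos) (auto intro: less_imp_le)
    show "L j < 1"
      unfolding L_def by (rule less)
  qed
  \<comment> \<open>The factor two makes \<open>b j\<close> strictly smaller than one even if \<open>L j = 0\<close>.\<close>
  define \<epsilon> where "\<epsilon> = Min (range (\<lambda>j. (1 - L j) / (2 * \<beta> j)))"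
  have \<epsilon>: "\<epsilon> > 0"
    using L \<beta> by (simp add: \<epsilon>_def)
  define b where "b = (\<lambda>j. \<epsilon> * \<beta> j)"
  have b: "0 < b j" "b j < 1 - L j" for j
  proof -
    show "0 < b j"
      using \<epsilon> \<beta> by (simp add: b_def)
    have "\<epsilon> \<le> (1 - L j) / (2 * \<beta> j)"
      by (simp add: \<epsilon>_def)
    then have "b j \<le> (1 - L j) / 2"
      using \<beta>[of j] by (simp add: b_def field_simps)
    then show "b j < 1 - L j"
      using L(2)[of j] by simp
  qed
  show ?thesis
  proof (rule admits_cubic_map_of_weights[OF n s, of b])
    fix j
    show "0 < b j" "b j < 1"
      using b[of j] L(1)[of j] by auto
    have "b j * (\<Sum>k\<in>UNIV. (s k)\<^sup>2 / cubic_weight b j k) = L j"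
    proof -
      have "cubic_weight b j k = \<epsilon> * cubic_weight \<beta> j k" for k
        by (simp add: cubic_weight_def b_def algebra_simps)
      then show ?thesis
        using \<epsilon> by (auto simp: L_def b_def sum_distrib_left intro!: sum.cong)
    qed
    then show "b j / (1 - b j) * (\<Sum>k\<in>UNIV. (s k)\<^sup>2 / cubic_weight b j k) \<le> 1"
      using b(2)[of j] L(1)[of j] by simp
  qed
qed

text \<open>Take \<open>\<beta>\<^sub>j = t\<^sub>j = \<surd>(1 - s\<^sub>j\<^sup>2)\<close>. The hypothesis says \<open>\<Sum>\<^sub>j (1 - t\<^sub>j) < 1\<close>; in particular
  \<open>t\<^sub>j + t\<^sub>k > 1\<close> for \<open>j \<noteq> k\<close>, and therefore
  \<open>s\<^sub>k\<^sup>2 = (1 - t\<^sub>k) (1 + t\<^sub>k) \<le> (1 - t\<^sub>k) (t\<^sub>j + 2 t\<^sub>k)\<close>. So the off-diagonal terms of row \<open>j\<close>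
  are at most \<open>t\<^sub>j\<close> times the sum of \<open>1 - t\<^sub>k\<close> over \<open>k \<noteq> j\<close>, which is less than
  \<open>t\<^sub>j\<^sup>2 = 1 - s\<^sub>j\<^sup>2\<close>. This choice comes from two variables, where the conditions
  of the two rows confine \<open>\<beta>\<^sub>1 / \<beta>\<^sub>2\<close> to an interval that contains \<open>t\<^sub>1 / t\<^sub>2\<close> whenever it is nonempty.\<close>

lemma admits_cubic_map_of_sum_sqrt:
  fixes s :: "'n::finite \<Rightarrow> real"
  assumes n: "CARD('n) > 2"
    and s: "\<And>j. 0 \<le> s j" "\<And>j. s j < 1"
    and sum: "(\<Sum>j\<in>UNIV. sqrt (1 - (s j)\<^sup>2)) > real CARD('n) - 1"
  shows "admits_cubic_map (quad_denom s)"
proof -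
  define t where "t = (\<lambda>j. sqrt (1 - (s j)\<^sup>2))"
  have s2: "(s j)\<^sup>2 < 1" for j
    using s[of j] by (simp add: power_less_one_iff)
  have t: "0 < t j" "t j \<le> 1" "(s j)\<^sup>2 = 1 - (t j)\<^sup>2" for j
    using s2[of j] by (auto simp: t_def)
  have defect: "(\<Sum>k\<in>UNIV. 1 - t k) < 1"
    using sum by (simp add: t_def sum_subtractf)
  show ?thesis
  proof (rule admits_cubic_map_of_ratios[OF n s, of t])
    fix j
    show "0 < t j"
      by (rule t)
    have "(s k)\<^sup>2 * (t j / cubic_weight t j k) \<le> t j * (1 - t k)" if "k \<noteq> j" for k
    proof -
      have "(\<Sum>i\<in>{j, k}. 1 - t i) \<le> (\<Sum>i\<in>UNIV. 1 - t i)"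
        by (rule sum_mono2) (use t in auto)
      then have "t j + t k > 1"
        using defect that by simp
      then have "(1 - t k) * (1 + t k) \<le> (1 - t k) * (t j + 2 * t k)"
        using t(2)[of k] by (intro mult_left_mono) auto
      then have "(s k)\<^sup>2 \<le> (1 - t k) * cubic_weight t j k"
        using that unfolding t(3) cubic_weight_def by (simp add: power2_eq_square algebra_simps)
      then have "t j * (s k)\<^sup>2 \<le> t j * ((1 - t k) * cubic_weight t j k)"
        using t(1)[of j] by simp
      then show ?thesis
        using cubic_weight_pos[of t j k, OF t(1)] by (simp add: field_simps)
    qed
    then have "(\<Sum>k\<in>UNIV - {j}. (s k)\<^sup>2 * (t j / cubic_weight t j k)) \<le>
        (\<Sum>k\<in>UNIV - {j}. t j * (1 - t k))"
      by (intro sum_mono) auto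
    also have "\<dots> = t j * ((\<Sum>k\<in>UNIV. 1 - t k) - (1 - t j))"
      by (simp add: sum_diff1 flip: sum_distrib_left)
    also have "\<dots> < t j * t j"
      using t(1)[of j] defect by (intro mult_strict_left_mono) auto
    finally have "(\<Sum>k\<in>UNIV - {j}. (s k)\<^sup>2 * (t j / cubic_weight t j k)) < (t j)\<^sup>2"
      by (simp add: power2_eq_square)
    moreover have "(\<Sum>k\<in>UNIV. (s k)\<^sup>2 * (t j / cubic_weight t j k)) =
        (s j)\<^sup>2 + (\<Sum>k\<in>UNIV - {j}. (s k)\<^sup>2 * (t j / cubic_weight t j k))"
      using t(1)[of j] by (simp add: sum.remove[of UNIV j] cubic_weight_def)
    ultimately show "(\<Sum>k\<in>UNIV. (s k)\<^sup>2 * (t j / cubic_weight t j k)) < 1"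
      using t(3)[of j] by simp
  qed
qed

text \<open>With constant weights each row is \<open>s\<^sup>2\<close> plus \<open>n - 1\<close> terms \<open>s\<^sup>2 / 3\<close>, hence
  \<open>s\<^sup>2 (n + 2) / 3\<close>.\<close>

lemma admits_cubic_map_of_equal:
  fixes s :: real
  assumes n: "CARD('n::finite) > 2"
    and s: "0 \<le> s" "s < sqrt (3 / (real CARD('n) + 2))"
  shows "admits_cubic_map (quad_denom (\<lambda>_ :: 'n. s))"
proof -
  have "s\<^sup>2 < (sqrt (3 / (real CARD('n) + 2)))\<^sup>2"
    using s by (intro power_strict_mono) auto
  then have s2: "s\<^sup>2 < 3 / (real CARD('n) + 2)"
    by simp
  then have bound: "s\<^sup>2 * (real CARD('n) + 2) < 3"
    by (simp add: pos_less_divide_eq)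
  have "3 / (real CARD('n) + 2) \<le> 1"
    using n by simp
  with s2 have "s\<^sup>2 < 1"
    by linarith
  then have "s < 1"
    using s(1) by (simp add: power_less_one_iff)
  then show ?thesis
  proof (intro admits_cubic_map_of_ratios[OF n, of "\<lambda>_. s" "\<lambda>_. 1"])
    fix j :: 'n
    have "(\<Sum>k\<in>UNIV. s\<^sup>2 * (1 / cubic_weight (\<lambda>_ :: 'n. 1) j k)) =
        s\<^sup>2 + (\<Sum>k\<in>UNIV - {j}. s\<^sup>2 * (1 / cubic_weight (\<lambda>_ :: 'n. 1) j k))"
      by (simp add: sum.remove[of UNIV j] cubic_weight_def)
    also have "(\<Sum>k\<in>UNIV - {j}. s\<^sup>2 * (1 / cubic_weight (\<lambda>_ :: 'n. 1) j k)) =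
        (\<Sum>k\<in>UNIV - {j}. s\<^sup>2 / 3)"
      by (intro sum.cong) (auto simp: cubic_weight_def)
    also have "s\<^sup>2 + \<dots> = s\<^sup>2 * (real CARD('n) + 2) / 3"
      using n by (simp add: card_Diff_singleton of_nat_diff field_simps)
    also have "\<dots> < 1"
      using bound by simp
    finally show "(\<Sum>k\<in>UNIV. s\<^sup>2 * (1 / cubic_weight (\<lambda>_ :: 'n. 1) j k)) < 1" .
  qed (use s in auto)
qed

section \<open>The two parameter ranges\<close>

lemma sqrt_range_nonempty:
  fixes n :: real
  assumes "n > 2"
  shows "sqrt (2 * n - 1) / n < sqrt (3 / (n + 2))"
proof -
  have "(2 * n - 1) * (n + 2) < 3 * n\<^sup>2"
    using mult_pos_pos[of "n - 1" "n - 2"] assms by (simp add: power2_eq_square algebra_simps)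
  then have "(2 * n - 1) / n\<^sup>2 < 3 / (n + 2)"
    using assms by (simp add: divide_simps)
  then have "sqrt ((2 * n - 1) / n\<^sup>2) < sqrt (3 / (n + 2))"
    by simp
  then show ?thesis
    using assms by (simp add: real_sqrt_divide)
qed

lemma sum_sqrt_condition_fails:
  fixes n s :: real
  assumes n: "n \<ge> 1" and s: "sqrt (2 * n - 1) / n \<le> s"
  shows "n * sqrt (1 - s\<^sup>2) \<le> n - 1"
proof -
  have "(sqrt (2 * n - 1) / n)\<^sup>2 \<le> s\<^sup>2"
    using assms by (intro power_mono) auto
  then have "2 * n - 1 \<le> s\<^sup>2 * n\<^sup>2"
    using n by (simp add: power_divide pos_divide_le_eq)
  then have "n\<^sup>2 * (1 - s\<^sup>2) \<le> (n - 1)\<^sup>2"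
    by (simp add: power2_eq_square algebra_simps)
  then have "sqrt (n\<^sup>2 * (1 - s\<^sup>2)) \<le> sqrt ((n - 1)\<^sup>2)"
    by (rule real_sqrt_le_mono)
  then show ?thesis
    using n by (simp add: real_sqrt_mult)
qed

theorem corollary6p4:
  assumes "CARD('n::finite) > 2"
  shows
    "(\<forall>\<sigma> :: 'n \<Rightarrow> real. (\<forall>j. 0 \<le> \<sigma> j \<and> \<sigma> j < 1) \<longrightarrow>
        (\<Sum>j\<in>UNIV. sqrt (1 - (\<sigma> j)\<^sup>2)) > real CARD('n) - 1 \<longrightarrow>
        admits_cubic_map (quad_denom \<sigma>)) \<and>
     \<not> (\<forall>\<sigma> :: 'n \<Rightarrow> real. (\<forall>j. 0 \<le> \<sigma> j \<and> \<sigma> j < 1) \<longrightarrow>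
        admits_cubic_map (quad_denom \<sigma>) \<longrightarrow>
        (\<Sum>j\<in>UNIV. sqrt (1 - (\<sigma> j)\<^sup>2)) > real CARD('n) - 1) \<and>
     {sqrt (2 * real CARD('n) - 1) / real CARD('n) ..< sqrt (3 / (real CARD('n) + 2))} \<noteq> {} \<and>
     (\<forall>s :: real. sqrt (2 * real CARD('n) - 1) / real CARD('n) \<le> s \<and>
          s < sqrt (3 / (real CARD('n) + 2)) \<longrightarrow>
        admits_cubic_map (quad_denom (\<lambda>j::'n. s)) \<and>
        \<not> (\<Sum>j\<in>(UNIV::'n set). sqrt (1 - s\<^sup>2)) > real CARD('n) - 1 \<and>
        real CARD('n) * sqrt (1 - s\<^sup>2) \<le> real CARD('n) - 1)"
proof -
  let ?n = "real CARD('n)"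
  let ?lo = "sqrt (2 * ?n - 1) / ?n" and ?hi = "sqrt (3 / (?n + 2))"
  have n: "?n > 2"
    using assms by simp
  have nonempty: "?lo < ?hi"
    by (rule sqrt_range_nonempty[OF n])
  have lo: "0 \<le> ?lo"
    using n by simp
  have maps: "admits_cubic_map (quad_denom (\<lambda>j::'n. s))" if "?lo \<le> s" "s < ?hi" for s
    using lo that by (intro admits_cubic_map_of_equal assms) auto
  have fails: "?n * sqrt (1 - s\<^sup>2) \<le> ?n - 1" if "?lo \<le> s" for s
    using n that by (intro sum_sqrt_condition_fails) auto
  have "?hi \<le> 1"
    using n by simp
  then have "?lo < 1"
    using nonempty by linarith
  then have "\<not> (\<forall>\<sigma> :: 'n \<Rightarrow> real. (\<forall>j. 0 \<le> \<sigma> j \<and> \<sigma> j < 1) \<longrightarrow>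
      admits_cubic_map (quad_denom \<sigma>) \<longrightarrow> (\<Sum>j\<in>UNIV. sqrt (1 - (\<sigma> j)\<^sup>2)) > ?n - 1)"
    using lo maps[of ?lo] fails[of ?lo] nonempty
    by (intro notI, elim allE[of _ "\<lambda>_. ?lo"]) auto
  moreover have "admits_cubic_map (quad_denom \<sigma>)"
    if "\<forall>j. 0 \<le> \<sigma> j \<and> \<sigma> j < 1" "(\<Sum>j\<in>UNIV. sqrt (1 - (\<sigma> j)\<^sup>2)) > ?n - 1" for \<sigma> :: "'n \<Rightarrow> real"
    using that by (intro admits_cubic_map_of_sum_sqrt assms) auto
  ultimately show ?thesis
    using nonempty maps fails by (auto simp: not_less)
qed

end
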